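(* Let $\tau\in\mathbb C$ with $\operatorname{Im}(\tau)>0$ satisfy $w\tau^2+u\tau+v=0$, where $u,v,w\in\mathbb Z$, $w>0$, $\gcd(u,v,w)=1$ and $u^2-4vw<0$. Let $\Lambda=\mathbb Z^2+\tau\mathbb Z^2\subset\mathbb C^2$, and for $\lambda\in\Lambda$ put $\bar\lambda:=w\tau\lambda\in\Lambda$. Then the set of bivectors in $\Lambda\wedge\Lambda$ of the form $\frac1r(\lambda\wedge\bar\lambda)$, where $\lambda\in\Lambda$ is primitive and $r$ is the integral content of $\lambda\wedge\bar\lambda$, is in one-to-one correspondence with the set of primitive vectors $(\alpha,\beta,\gamma,\eta)\in\mathbb Z^4$ such that $\alpha,\beta\ge 0$ and $$\alpha\beta-\gamma(\gamma+u\eta)=vw\,\eta^2 .$$ The correspondence sends $\frac1r(\lambda\wedge\bar\lambda)$, with $\lambda=(a+\tau c,\;b+\tau d)$, $a,b,c,d\in\mathbb Z$, to $$(\alpha,\beta,\gamma,\eta)=\tfrac1r\big(wa^2-uac+vc^2,\;\; wb^2-ubd+vd^2,\;\; wab-uad+vcd,\;\; ad-bc\big).$$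
   Context: $\Lambda$ is regarded as a free $\mathbb Z$-module of rank 4, and $\Lambda\wedge\Lambda$ is its second exterior power over $\mathbb Z$ (free of rank 6). The integral content of a nonzero element $x$ of a free $\mathbb Z$-module is the largest positive integer $r$ such that $x$ is $r$ times an element of the module; $x$ is primitive if its content is $1$. Because $w\tau\cdot 1=w\tau$ and $w\tau\cdot\tau=-v-u\tau$, multiplication by $w\tau$ maps $\Lambda$ into itself, so $\bar\lambda\in\Lambda$ (this bar is not complex conjugation). *)

theory Defs
  imports "HOL-Analysis.Analysis" "HOL-Algebra.Free_Abelian_Groups"
begin

text \<open>
  \<open>\<int>\<close>-modules are treated as abelian groups in the sense of HOL-Algebra, whose notation is
  multiplicative: for a natural number \<open>r\<close>, the multiple \<open>r x\<close> is written \<open>x [^] r\<close>,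
  and the zero element is \<open>\<one>\<close>.
\<close>

definition additive_group :: "'a::ab_group_add set \<Rightarrow> 'a monoid" where
  "additive_group S = \<lparr>carrier = S, monoid.mult = (+), one = 0\<rparr>"

text \<open>Meaningful for nonzero elements of free \<open>\<int>\<close>-modules only; for zero the set of admissible
  \<open>r\<close> is unbounded and the value is unspecified.\<close>

definition integral_content :: "('a, 'b) monoid_scheme \<Rightarrow> 'a \<Rightarrow> nat" where
  "integral_content G x =
     (GREATEST r::nat. 0 < r \<and> (\<exists>y\<in>carrier G. y [^]\<^bsub>G\<^esub> r = x))"

definition primitive :: "('a, 'b) monoid_scheme \<Rightarrow> 'a \<Rightarrow> bool" where
  "primitive G x \<longleftrightarrow> x \<in> carrier G \<and> x \<noteq> \<one>\<^bsub>G\<^esub> \<and> integral_content G x = 1"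

text \<open>\<open>is_primitive_part G x y\<close> says \<open>y = x / r\<close>, where \<open>r\<close> is the content of \<open>x\<close>.  In a free
  \<open>\<int>\<close>-module and for \<open>x\<close> nonzero there is exactly one such \<open>y\<close>.\<close>

definition is_primitive_part :: "('a, 'b) monoid_scheme \<Rightarrow> 'a \<Rightarrow> 'a \<Rightarrow> bool" where
  "is_primitive_part G x y \<longleftrightarrow> y \<in> carrier G \<and> y [^]\<^bsub>G\<^esub> integral_content G x = x"

text \<open>
  The exterior square over \<open>\<int>\<close> of an abelian group \<open>G\<close>: the free abelian group on the pairs of
  elements of \<open>G\<close> modulo the subgroup generated by the relations below.  Over \<open>\<int>\<close>, additivity
  in each argument already gives bilinearity.
\<close>

definition wedge_relations :: "('a, 'b) monoid_scheme \<Rightarrow> ('a \<times> 'a \<Rightarrow>\<^sub>0 int) set" where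
  "wedge_relations G =
     {frag_of (x \<otimes>\<^bsub>G\<^esub> y, z) - frag_of (x, z) - frag_of (y, z) | x y z.
        x \<in> carrier G \<and> y \<in> carrier G \<and> z \<in> carrier G} \<union>
     {frag_of (z, x \<otimes>\<^bsub>G\<^esub> y) - frag_of (z, x) - frag_of (z, y) | x y z.
        x \<in> carrier G \<and> y \<in> carrier G \<and> z \<in> carrier G} \<union>
     {frag_of (x, x) | x. x \<in> carrier G}"

definition wedge_kernel :: "('a, 'b) monoid_scheme \<Rightarrow> ('a \<times> 'a \<Rightarrow>\<^sub>0 int) set" where
  "wedge_kernel G =
     generate (free_Abelian_group (carrier G \<times> carrier G)) (wedge_relations G)"

definition exterior_square :: "('a, 'b) monoid_scheme \<Rightarrow> ('a \<times> 'a \<Rightarrow>\<^sub>0 int) set monoid" where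
  "exterior_square G = free_Abelian_group (carrier G \<times> carrier G) Mod wedge_kernel G"

definition wedge :: "('a, 'b) monoid_scheme \<Rightarrow> 'a \<Rightarrow> 'a \<Rightarrow> ('a \<times> 'a \<Rightarrow>\<^sub>0 int) set" where
  "wedge G x y =
     wedge_kernel G #>\<^bsub>free_Abelian_group (carrier G \<times> carrier G)\<^esub> frag_of (x, y)"

definition lattice_point :: "complex \<Rightarrow> int \<Rightarrow> int \<Rightarrow> int \<Rightarrow> int \<Rightarrow> complex ^ 2" where
  "lattice_point \<tau> a b c d =
     vector [of_int a + \<tau> * of_int c, of_int b + \<tau> * of_int d]"

definition Lattice :: "complex \<Rightarrow> (complex ^ 2) monoid" where
  "Lattice \<tau> = additive_group {lattice_point \<tau> a b c d | a b c d. True}"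

definition lattice_bar :: "complex \<Rightarrow> int \<Rightarrow> complex ^ 2 \<Rightarrow> complex ^ 2" where
  "lattice_bar \<tau> w l = (of_int w * \<tau>) *s l"

lemma lattice_bar_closed:
  assumes "of_int w * \<tau>\<^sup>2 + of_int u * \<tau> + of_int v = 0" and "l \<in> carrier (Lattice \<tau>)"
  shows "lattice_bar \<tau> w l \<in> carrier (Lattice \<tau>)"
proof -
  obtain a b c d where l: "l = lattice_point \<tau> a b c d"
    using assms(2) by (auto simp: Lattice_def additive_group_def)
  have rel: "of_int w * (\<tau> * \<tau>) = - of_int v - of_int u * \<tau>"
    using assms(1) by (simp add: power2_eq_square add_eq_0_iff algebra_simps)
  have entry: "of_int w * \<tau> * (of_int p + \<tau> * of_int q) =
      of_int (- v * q) + \<tau> * of_int (w * p - u * q)" for p q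
  proof -
    have "of_int w * \<tau> * (of_int p + \<tau> * of_int q) =
        of_int w * \<tau> * of_int p + of_int w * (\<tau> * \<tau>) * of_int q"
      by (simp add: algebra_simps)
    then show ?thesis
      unfolding rel by (simp add: algebra_simps)
  qed
  have "lattice_bar \<tau> w l =
      lattice_point \<tau> (- v * c) (- v * d) (w * a - u * c) (w * b - u * d)"
    unfolding l lattice_bar_def lattice_point_def vec_eq_iff forall_2
    using entry[of a c] entry[of b d] by simp
  then show ?thesis
    by (auto simp: Lattice_def additive_group_def)
qed

definition bivectors :: "complex \<Rightarrow> int \<Rightarrow> ((complex ^ 2) \<times> (complex ^ 2) \<Rightarrow>\<^sub>0 int) set set" where
  "bivectors \<tau> w =
     {\<omega>. \<exists>l. primitive (Lattice \<tau>) l \<and>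
        is_primitive_part (exterior_square (Lattice \<tau>))
          (wedge (Lattice \<tau>) l (lattice_bar \<tau> w l)) \<omega>}"

definition solutions :: "int \<Rightarrow> int \<Rightarrow> int \<Rightarrow> (int \<times> int \<times> int \<times> int) set" where
  "solutions u v w =
     {(\<alpha>, \<beta>, \<gamma>, \<eta>). primitive (additive_group UNIV) (\<alpha>, \<beta>, \<gamma>, \<eta>) \<and>
        \<alpha> \<ge> 0 \<and> \<beta> \<ge> 0 \<and> \<alpha> * \<beta> - \<gamma> * (\<gamma> + u * \<eta>) = v * w * \<eta>\<^sup>2}"

end

theory Submission
  imports Defs
begin

text \<open>
  In Pluecker coordinates, which identify \<open>\<Lambda> \<and> \<Lambda>\<close> with \<open>\<int>\<^sup>6\<close>, the bivector \<open>\<lambda> \<and> \<lambda>-bar\<close> is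
  \<open>(-v\<eta>, \<alpha>, \<gamma>, \<gamma> + u\<eta>, \<beta>, -w\<eta>)\<close>, where \<open>\<alpha>, \<beta>, \<gamma>, \<eta>\<close> are the four forms evaluated at \<open>\<lambda>\<close>.
  This linear map of \<open>(\<alpha>, \<beta>, \<gamma>, \<eta>)\<close> is injective and, because \<open>gcd(u, v, w) = 1\<close>, preserves the
  content; so dividing the bivector by its content amounts to dividing the four values by theirs.
  The quadratic equation is the Pluecker relation, and \<open>\<alpha>, \<beta> \<ge> 0\<close> because
  \<open>wx\<^sup>2 - uxy + vy\<^sup>2\<close> is positive definite.  Conversely, for a primitive solution with \<open>\<alpha> > 0\<close>
  the vector \<open>(\<alpha>, \<gamma> + u\<eta> + \<tau>w\<eta>)\<close> has the values \<open>w\<alpha>(\<alpha>, \<beta>, \<gamma>, \<eta>)\<close>; dividing it by its content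
  gives the required \<open>\<lambda>\<close>.  If \<open>\<alpha> = 0\<close>, definiteness forces the solution \<open>(0, 1, 0, 0)\<close>.
\<close>

section \<open>Integral content\<close>

lemma carrier_additive_group [simp]: "carrier (additive_group S) = S"
  and mult_additive_group [simp]: "x \<otimes>\<^bsub>additive_group S\<^esub> y = x + y"
  and one_additive_group [simp]: "\<one>\<^bsub>additive_group S\<^esub> = 0"
  by (simp_all add: additive_group_def)

lemma comm_group_additive_group:
  assumes "0 \<in> S" "\<And>x y. x \<in> S \<Longrightarrow> y \<in> S \<Longrightarrow> x + y \<in> S" "\<And>x. x \<in> S \<Longrightarrow> - x \<in> S"
  shows "comm_group (additive_group S)"
proof (rule comm_groupI)
  fix x assume "x \<in> carrier (additive_group S)"
  with assms(3) show "\<exists>y\<in>carrier (additive_group S). y \<otimes>\<^bsub>additive_group S\<^esub> x = \<one>\<^bsub>additive_group S\<^esub>"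
    by (intro bexI[of _ "- x"]) auto
qed (use assms in \<open>auto simp: add.assoc add.commute\<close>)

lemma comm_group_additive_group_UNIV [simp]: "comm_group (additive_group UNIV)"
  by (rule comm_group_additive_group) auto

lemma group_additive_group_UNIV [simp]: "group (additive_group UNIV)"
  by (rule comm_group.axioms(2)) simp

lemma inv_additive_group_UNIV [simp]: "inv\<^bsub>additive_group UNIV\<^esub> x = - x"
  by (rule group.inv_equality) auto

lemma additive_group_nat_pow_Pair [simp]:
  "(x, y) [^]\<^bsub>additive_group UNIV\<^esub> (n::nat) =
     (x [^]\<^bsub>additive_group UNIV\<^esub> n, y [^]\<^bsub>additive_group UNIV\<^esub> n)"
  by (induction n) (simp_all add: zero_prod_def)

lemma additive_group_nat_pow_int [simp]:
  "(x::int) [^]\<^bsub>additive_group UNIV\<^esub> (n::nat) = int n * x"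
  by (induction n) (simp_all add: algebra_simps)

lemma additive_group_int_pow_Pair [simp]:
  "(x, y) [^]\<^bsub>additive_group UNIV\<^esub> (n::int) =
     (x [^]\<^bsub>additive_group UNIV\<^esub> n, y [^]\<^bsub>additive_group UNIV\<^esub> n)"
  by (cases "n < 0")
    (simp_all only: int_pow_def2 if_True if_False additive_group_nat_pow_Pair
      inv_additive_group_UNIV uminus_Pair refl)

lemma additive_group_int_pow_int [simp]:
  "(x::int) [^]\<^bsub>additive_group UNIV\<^esub> (n::int) = n * x"
  by (simp add: int_pow_def2)

text \<open>The divisors of a positive \<open>n\<close> are bounded by \<open>n\<close>, so the
  \<open>GREATEST\<close> in the definition is attained.\<close>

lemma integral_content_eqI:
  assumes "n > 0" "\<And>r. 0 < r \<Longrightarrow> (\<exists>y\<in>carrier G. y [^]\<^bsub>G\<^esub> r = x) \<longleftrightarrow> r dvd n"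
  shows "integral_content G x = n"
  unfolding integral_content_def
proof (rule Greatest_equality)
  show "0 < n \<and> (\<exists>y\<in>carrier G. y [^]\<^bsub>G\<^esub> n = x)"
    using assms(1) assms(2)[OF assms(1)] dvd_refl[of n] by blast
  show "r \<le> n" if "0 < r \<and> (\<exists>y\<in>carrier G. y [^]\<^bsub>G\<^esub> r = x)" for r
    using assms(1) assms(2)[of r] that by (metis dvd_imp_le)
qed

lemma integral_content_cong:
  assumes "\<And>r::nat. (\<exists>y\<in>carrier G. y [^]\<^bsub>G\<^esub> r = x) \<longleftrightarrow> (\<exists>y\<in>carrier H. y [^]\<^bsub>H\<^esub> r = z)"
  shows "integral_content G x = integral_content H z"
  by (simp only: integral_content_def assms)

lemma integral_content_iso:
  assumes "h \<in> iso G H" "group G" "group H" "x \<in> carrier G"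
  shows "integral_content H (h x) = integral_content G x"
proof (rule integral_content_cong)
  fix r :: nat
  have h: "h \<in> hom G H" "inj_on h (carrier G)" "h ` carrier G = carrier H"
    using assms(1) by (auto simp: iso_def bij_betw_def)
  have "h y [^]\<^bsub>H\<^esub> r = h x \<longleftrightarrow> y [^]\<^bsub>G\<^esub> r = x" if "y \<in> carrier G" for y
  proof -
    have "h y [^]\<^bsub>H\<^esub> r = h (y [^]\<^bsub>G\<^esub> r)"
      using hom_nat_pow[OF h(1) that assms(2,3)] by (rule sym)
    moreover have "y [^]\<^bsub>G\<^esub> r \<in> carrier G"
      using that by (rule monoid.nat_pow_closed[OF group.is_monoid[OF assms(2)]])
    ultimately show ?thesis
      using inj_on_eq_iff[OF h(2) _ assms(4)] by simp
  qed
  then show "(\<exists>y\<in>carrier H. y [^]\<^bsub>H\<^esub> r = h x) \<longleftrightarrow> (\<exists>y\<in>carrier G. y [^]\<^bsub>G\<^esub> r = x)"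
    unfolding h(3)[symmetric] by blast
qed

lemma primitive_iso:
  assumes "h \<in> iso G H" "group G" "group H" "x \<in> carrier G"
  shows "primitive H (h x) \<longleftrightarrow> primitive G x"
proof -
  have h: "h \<in> hom G H" "inj_on h (carrier G)"
    using assms(1) by (auto simp: iso_def bij_betw_def)
  then have "h x = \<one>\<^bsub>H\<^esub> \<longleftrightarrow> x = \<one>\<^bsub>G\<^esub>"
    using inj_on_eq_iff[OF h(2) assms(4) monoid.one_closed[OF group.is_monoid[OF assms(2)]]]
      hom_one[OF h(1) assms(2,3)] by simp
  then show ?thesis
    unfolding primitive_def integral_content_iso[OF assms]
    using assms(4) h(1) by (auto simp: hom_in_carrier)
qed

text \<open>This computes the content in rank 4. Unlike \<open>integral_content\<close> it has a
  definite value at the zero vector, namely 0, so \<open>gcd4 s = 1\<close> already excludes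
  \<open>s = 0\<close>.\<close>

definition gcd4 :: "int \<times> int \<times> int \<times> int \<Rightarrow> int" where
  "gcd4 = (\<lambda>(a, b, c, d). gcd a (gcd b (gcd c d)))"

lemma gcd4_eq_0_iff: "gcd4 s = 0 \<longleftrightarrow> s = 0"
  by (cases s) (simp add: gcd4_def zero_prod_def)

lemma gcd4_nonneg: "gcd4 s \<ge> 0"
  by (cases s) (simp add: gcd4_def)

lemma gcd4_pow: "gcd4 (s [^]\<^bsub>additive_group UNIV\<^esub> (n::nat)) = int n * gcd4 s"
  by (cases s) (simp add: gcd4_def gcd_mult_left)

lemma root_Z4_iff:
  "(\<exists>y\<in>carrier (additive_group UNIV). y [^]\<^bsub>additive_group UNIV\<^esub> r = s) \<longleftrightarrow> int r dvd gcd4 s"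
proof (cases s)
  case (fields a b c d)
  have "int r dvd gcd4 s \<longleftrightarrow> int r dvd a \<and> int r dvd b \<and> int r dvd c \<and> int r dvd d"
    by (simp add: fields gcd4_def)
  also have "\<dots> \<longleftrightarrow> (\<exists>y\<in>carrier (additive_group UNIV). y [^]\<^bsub>additive_group UNIV\<^esub> r = s)"
    unfolding fields dvd_def by auto
  finally show ?thesis ..
qed

lemma integral_content_Z4:
  assumes "s \<noteq> 0"
  shows "int (integral_content (additive_group UNIV) s) = gcd4 s"
proof -
  have "gcd4 s > 0"
    using assms gcd4_nonneg[of s] gcd4_eq_0_iff[of s] by linarith
  then have "integral_content (additive_group UNIV) s = nat (gcd4 s)"
    by (intro integral_content_eqI) (auto simp: root_Z4_iff[simplified] int_dvd_int_iff[symmetric])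
  then show ?thesis
    using \<open>gcd4 s > 0\<close> by simp
qed

lemma primitive_Z4_iff: "primitive (additive_group UNIV) s \<longleftrightarrow> gcd4 s = 1"
proof (cases "s = 0")
  case True
  then show ?thesis
    using gcd4_eq_0_iff[of s] by (simp add: primitive_def)
next
  case False
  then show ?thesis
    using integral_content_Z4[OF False] by (auto simp: primitive_def)
qed

lemma gcd4_divide:
  assumes "s \<noteq> 0"
  obtains t n where "gcd4 t = 1" "n > 0" "s = t [^]\<^bsub>additive_group UNIV\<^esub> (n::nat)"
proof -
  have pos: "gcd4 s > 0"
    using assms gcd4_nonneg[of s] gcd4_eq_0_iff[of s] by linarith
  then obtain t where t: "t [^]\<^bsub>additive_group UNIV\<^esub> nat (gcd4 s) = s"
    using root_Z4_iff[of "nat (gcd4 s)" s] by auto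
  have "int (nat (gcd4 s)) * gcd4 t = gcd4 s"
    unfolding gcd4_pow[symmetric] t ..
  with pos have "gcd4 t = 1"
    by (metis int_nat_eq less_imp_le mult_cancel_left1 order_less_irrefl)
  with t pos show ?thesis
    by (intro that[of t "nat (gcd4 s)"]) auto
qed

section \<open>The exterior square of an abelian group\<close>

text \<open>Over \<int>, additivity in each argument is bilinearity. The target is a group in
  multiplicative notation, so that \<open>wedge\<close> itself, with values in the exterior square,
  is an instance.\<close>

definition alternating_form ::
  "('a, 'b) monoid_scheme \<Rightarrow> ('c, 'd) monoid_scheme \<Rightarrow> ('a \<Rightarrow> 'a \<Rightarrow> 'c) \<Rightarrow> bool" where
  "alternating_form G A f \<longleftrightarrow>
     (\<forall>z\<in>carrier G. (\<lambda>x. f x z) \<in> hom G A \<and> f z \<in> hom G A \<and> f z z = \<one>\<^bsub>A\<^esub>)"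

lemma hom_eq_on_generate:
  assumes "f \<in> hom G H" "g \<in> hom G H" "group G" "group H" "B \<subseteq> carrier G"
    and "\<And>b. b \<in> B \<Longrightarrow> f b = g b" and "x \<in> generate G B"
  shows "f x = g x"
proof -
  interpret f: group_hom G H f
    by (simp add: assms group_hom_axioms_def group_hom_def)
  interpret g: group_hom G H g
    by (simp add: assms group_hom_axioms_def group_hom_def)
  show ?thesis
    using assms(7)
  proof induction
    case (inv b)
    then show ?case
      using assms(5,6) by (metis f.hom_inv g.hom_inv subsetD)
  next
    case (eng x y)
    then show ?case
      using f.G.generate_in_carrier[OF assms(5)] by simp
  qed (use assms(6) in simp_all)
qed

text \<open>Generation is used once per argument: first in the second one, with the first fixed in
  \<open>B\<close>, and then in the first one.\<close>

lemma alternating_form_eqI: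
  assumes "alternating_form G A f" "alternating_form G A g" "group G" "group A"
    and "B \<subseteq> carrier G" "carrier G = generate G B"
    and "\<And>x y. x \<in> B \<Longrightarrow> y \<in> B \<Longrightarrow> f x y = g x y"
    and "x \<in> carrier G" "y \<in> carrier G"
  shows "f x y = g x y"
proof -
  have "f b y = g b y" if "b \<in> B" for b
    by (rule hom_eq_on_generate[of "f b" G A "g b" B y])
      (use assms that in \<open>auto simp: alternating_form_def\<close>)
  then show ?thesis
    by (intro hom_eq_on_generate[of "\<lambda>x. f x y" G A "\<lambda>x. g x y" B x])
      (use assms in \<open>auto simp: alternating_form_def\<close>)
qed

text \<open>Expanding the trivial value at the pair (x + y, x + y) leaves only the two mixed terms,
  whose product is therefore trivial.\<close>

lemma alternating_form_swap:
  assumes "alternating_form G A f" "group G" "group A" "x \<in> carrier G" "y \<in> carrier G"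
  shows "f y x = inv\<^bsub>A\<^esub> f x y"
proof -
  interpret G: group G by fact
  interpret A: group A by fact
  have hom: "f (a \<otimes>\<^bsub>G\<^esub> b) c = f a c \<otimes>\<^bsub>A\<^esub> f b c" "f c (a \<otimes>\<^bsub>G\<^esub> b) = f c a \<otimes>\<^bsub>A\<^esub> f c b"
      "f a a = \<one>\<^bsub>A\<^esub>" "f a b \<in> carrier A"
    if "a \<in> carrier G" "b \<in> carrier G" "c \<in> carrier G" for a b c
    using assms(1) that by (auto simp: alternating_form_def hom_def)
  have xy: "x \<otimes>\<^bsub>G\<^esub> y \<in> carrier G"
    using assms by simp
  have "\<one>\<^bsub>A\<^esub> = f (x \<otimes>\<^bsub>G\<^esub> y) (x \<otimes>\<^bsub>G\<^esub> y)"
    using hom(3)[OF xy xy xy] by simp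
  also have "\<dots> = f x y \<otimes>\<^bsub>A\<^esub> f y x"
    using assms(4,5) by (simp add: hom(1)[OF assms(4,5) xy] hom(2-4))
  finally show ?thesis
    using hom(4)[OF assms(4,5,4)] hom(4)[OF assms(5,4,4)] by (metis A.inv_equality A.inv_comm)
qed

lemma alternating_form_hom:
  assumes "alternating_form G A f" "h \<in> hom A B" "group A" "group B"
  shows "alternating_form G B (\<lambda>x y. h (f x y))"
  using assms(1,2) hom_one[OF assms(2-4)] by (auto simp: alternating_form_def hom_def Pi_def)

lemma alternating_form_comp_hom:
  assumes "alternating_form G A f" "k \<in> hom H G"
  shows "alternating_form H A (\<lambda>x y. f (k x) (k y))"
  using assms unfolding alternating_form_def hom_def Pi_def by simp

lemma keys_diff_subsetI:
  "Poly_Mapping.keys a \<subseteq> S \<Longrightarrow> Poly_Mapping.keys b \<subseteq> S \<Longrightarrow> Poly_Mapping.keys (a - b) \<subseteq> S"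
  using keys_diff[of a b] by blast

section \<open>The exterior square as a quotient, and its universal property\<close>

context comm_group
begin

abbreviation (input) pair_group :: "('a \<times> 'a \<Rightarrow>\<^sub>0 int) monoid" where
  "pair_group \<equiv> free_Abelian_group (carrier G \<times> carrier G)"

lemma wedge_relations_subset: "wedge_relations G \<subseteq> carrier pair_group"
proof -
  have "frag_of p - frag_of q - frag_of r \<in> carrier pair_group"
    if "p \<in> carrier G \<times> carrier G" "q \<in> carrier G \<times> carrier G" "r \<in> carrier G \<times> carrier G"
    for p q r
    using that by (simp add: keys_diff_subsetI)
  then show ?thesis
    unfolding wedge_relations_def
    by (intro Un_least subsetI; elim CollectE exE conjE; simp del: carrier_free_Abelian_group_iff)
qed

lemma subgroup_wedge_kernel: "subgroup (wedge_kernel G) pair_group"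
  unfolding wedge_kernel_def
  by (rule group.generate_is_subgroup[OF group_free_Abelian_group wedge_relations_subset])

lemma normal_wedge_kernel: "wedge_kernel G \<lhd> pair_group"
  by (simp add: abelian_free_Abelian_group comm_group.normal_iff_subgroup subgroup_wedge_kernel)

lemma comm_group_exterior_square: "comm_group (exterior_square G)"
  unfolding exterior_square_def
  by (rule comm_group.abelian_FactGroup[OF abelian_free_Abelian_group subgroup_wedge_kernel])

lemma group_exterior_square: "group (exterior_square G)"
  by (rule comm_group.axioms(2)[OF comm_group_exterior_square])

lemma wedge_closed:
  "x \<in> carrier G \<Longrightarrow> y \<in> carrier G \<Longrightarrow> wedge G x y \<in> carrier (exterior_square G)"
  by (auto simp: wedge_def exterior_square_def carrier_FactGroup)

lemma wedge_kernel_coset_eqI: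
  assumes "a \<in> carrier pair_group" "b \<in> carrier pair_group" "a - b \<in> wedge_kernel G"
  shows "wedge_kernel G #>\<^bsub>pair_group\<^esub> a = wedge_kernel G #>\<^bsub>pair_group\<^esub> b"
proof -
  have "a \<in> wedge_kernel G #>\<^bsub>pair_group\<^esub> b"
    unfolding r_coset_def by (rule UN_I[OF assms(3)]) simp
  then show ?thesis
    using group.repr_independence[OF group_free_Abelian_group _ assms(2) subgroup_wedge_kernel] by simp
qed

text \<open>Both additivity families in \<open>wedge_relations\<close> have the shape p - q - r on
  generators; treating pairs as single generators handles the two at once.\<close>

lemma wedge_sum_eqI:
  assumes "p \<in> carrier G \<times> carrier G" "q \<in> carrier G \<times> carrier G" "r \<in> carrier G \<times> carrier G"
    and "frag_of p - frag_of q - frag_of r \<in> wedge_relations G"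
  shows "wedge G (fst p) (snd p) =
    wedge G (fst q) (snd q) \<otimes>\<^bsub>exterior_square G\<^esub> wedge G (fst r) (snd r)"
proof -
  have "frag_of p - (frag_of q + frag_of r) \<in> wedge_kernel G"
    unfolding wedge_kernel_def using generate.incl[OF assms(4)] by (simp add: diff_diff_eq)
  moreover have "frag_of q + frag_of r \<in> carrier pair_group"
    using assms monoid.m_closed[OF group.is_monoid[OF group_free_Abelian_group[of "carrier G \<times> carrier G"]],
        of "frag_of q" "frag_of r"] by simp
  ultimately have "wedge_kernel G #>\<^bsub>pair_group\<^esub> frag_of p =
      wedge_kernel G #>\<^bsub>pair_group\<^esub> (frag_of q \<otimes>\<^bsub>pair_group\<^esub> frag_of r)"
    using assms by (simp add: wedge_kernel_coset_eqI)
  then show ?thesis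
    using normal.rcos_sum[OF normal_wedge_kernel, of "frag_of q" "frag_of r"] assms
    by (simp add: wedge_def exterior_square_def)
qed

lemma alternating_form_wedge: "alternating_form G (exterior_square G) (wedge G)"
  unfolding alternating_form_def
proof (intro ballI conjI homI)
  fix x y z assume *: "x \<in> carrier G" "y \<in> carrier G" "z \<in> carrier G"
  have "frag_of (x \<otimes> y, z) - frag_of (x, z) - frag_of (y, z) \<in> wedge_relations G"
    "frag_of (z, x \<otimes> y) - frag_of (z, x) - frag_of (z, y) \<in> wedge_relations G"
    using * unfolding wedge_relations_def by blast+
  then show "wedge G (x \<otimes> y) z = wedge G x z \<otimes>\<^bsub>exterior_square G\<^esub> wedge G y z"
    "wedge G z (x \<otimes> y) = wedge G z x \<otimes>\<^bsub>exterior_square G\<^esub> wedge G z y"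
    using * wedge_sum_eqI[of "(x \<otimes> y, z)" "(x, z)" "(y, z)"]
      wedge_sum_eqI[of "(z, x \<otimes> y)" "(z, x)" "(z, y)"] by auto
next
  fix x assume "x \<in> carrier G"
  then have "frag_of (x, x) \<in> wedge_kernel G"
    unfolding wedge_kernel_def wedge_relations_def by (intro generate.incl) blast
  then show "wedge G x x = \<one>\<^bsub>exterior_square G\<^esub>"
    using subgroup.rcos_const[OF subgroup_wedge_kernel group_free_Abelian_group]
    by (simp add: wedge_def exterior_square_def)
qed (simp_all add: wedge_closed)

text \<open>Wedges generate the exterior square. Both maps are pulled back to the free abelian group
  on pairs, where they agree on the generators and hence everywhere.\<close>

lemma exterior_square_hom_ext:
  assumes "f \<in> hom (exterior_square G) H" "g \<in> hom (exterior_square G) H" "group H"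
    and eq: "\<And>x y. x \<in> carrier G \<Longrightarrow> y \<in> carrier G \<Longrightarrow> f (wedge G x y) = g (wedge G x y)"
    and "\<omega> \<in> carrier (exterior_square G)"
  shows "f \<omega> = g \<omega>"
proof -
  interpret N: normal "wedge_kernel G" pair_group
    by (rule normal_wedge_kernel)
  let ?q = "\<lambda>a. wedge_kernel G #>\<^bsub>pair_group\<^esub> a"
  have q: "?q \<in> hom pair_group (exterior_square G)"
    unfolding exterior_square_def by (rule N.r_coset_hom_Mod)
  obtain a where a: "a \<in> carrier pair_group" "\<omega> = ?q a"
    using assms(5) by (auto simp: exterior_square_def carrier_FactGroup)
  interpret f: group_hom pair_group H "f \<circ> ?q"
    using Group.hom_compose[OF q assms(1)] assms(3) by (simp add: group_hom_def group_hom_axioms_def)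
  interpret g: group_hom pair_group H "g \<circ> ?q"
    using Group.hom_compose[OF q assms(2)] assms(3) by (simp add: group_hom_def group_hom_axioms_def)
  have "(f \<circ> ?q) a = (g \<circ> ?q) a"
  proof (rule free_Abelian_group_induct[of a "carrier G \<times> carrier G"])
    show "Poly_Mapping.keys a \<subseteq> carrier G \<times> carrier G"
      using a(1) by simp
  next
    show "(f \<circ> ?q) 0 = (g \<circ> ?q) 0"
      using f.hom_one g.hom_one by simp
  next
    fix x y :: "'a \<times> 'a \<Rightarrow>\<^sub>0 int"
    assume 2: "Poly_Mapping.keys x \<subseteq> carrier G \<times> carrier G" "Poly_Mapping.keys y \<subseteq> carrier G \<times> carrier G"
      "(f \<circ> ?q) x = (g \<circ> ?q) x" "(f \<circ> ?q) y = (g \<circ> ?q) y"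
    then have *: "x \<in> carrier pair_group" "- y \<in> carrier pair_group" "y \<in> carrier pair_group"
      by auto
    have xy: "x - y = x \<otimes>\<^bsub>pair_group\<^esub> inv\<^bsub>pair_group\<^esub> y"
      using 2 by simp
    show "(f \<circ> ?q) (x - y) = (g \<circ> ?q) (x - y)"
      unfolding xy f.hom_mult[OF *(1) N.inv_closed[OF *(3)]] g.hom_mult[OF *(1) N.inv_closed[OF *(3)]]
        f.hom_inv[OF *(3)] g.hom_inv[OF *(3)] 2 ..
  next
    fix p :: "'a \<times> 'a"
    assume "p \<in> carrier G \<times> carrier G"
    then show "(f \<circ> ?q) (frag_of p) = (g \<circ> ?q) (frag_of p)"
      using eq[of "fst p" "snd p"] by (auto simp: wedge_def)
  qed
  then show ?thesis
    using a by simp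
qed

text \<open>Freeness extends \<open>f\<close> from pairs to a homomorphism \<open>g\<close>. Its
  kernel is a subgroup containing the defining relations, hence all of
  \<open>wedge_kernel G\<close>, so \<open>g\<close> factors through the quotient.\<close>

lemma exterior_square_universal:
  assumes "alternating_form G A f" "comm_group A"
  obtains h where "h \<in> hom (exterior_square G) A"
    "\<And>x y. x \<in> carrier G \<Longrightarrow> y \<in> carrier G \<Longrightarrow> h (wedge G x y) = f x y"
proof -
  interpret A: comm_group A by fact
  have f: "f (x \<otimes> y) z = f x z \<otimes>\<^bsub>A\<^esub> f y z" "f z (x \<otimes> y) = f z x \<otimes>\<^bsub>A\<^esub> f z y"
      "f x x = \<one>\<^bsub>A\<^esub>" "f x y \<in> carrier A"
    if "x \<in> carrier G" "y \<in> carrier G" "z \<in> carrier G" for x y z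
    using assms(1) that by (auto simp: alternating_form_def hom_def)
  have "case_prod f ` (carrier G \<times> carrier G) \<subseteq> carrier A"
    using f(4) by auto
  then obtain g where g: "g \<in> hom pair_group A"
      "\<And>p. p \<in> carrier G \<times> carrier G \<Longrightarrow> g (frag_of p) = case_prod f p"
    using A.free_Abelian_group_universal[of "case_prod f"] by metis
  interpret g: group_hom pair_group A g
    using g(1) by (simp add: group_hom_def group_hom_axioms_def)
  have diff: "g (a - b) = g a \<otimes>\<^bsub>A\<^esub> inv\<^bsub>A\<^esub> g b"
    if "a \<in> carrier pair_group" "b \<in> carrier pair_group" for a b
    using g.hom_mult[OF that(1) g.G.inv_closed[OF that(2)]] g.hom_inv[OF that(2)] that by simp
  \<comment> \<open>The image of such a relation is the commutator of the values of \<open>f\<close>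
    at \<open>q\<close> and \<open>r\<close>, which vanishes because \<open>A\<close> is
    abelian.\<close>
  have sum: "g (frag_of p - frag_of q - frag_of r) = \<one>\<^bsub>A\<^esub>"
    if "p \<in> carrier G \<times> carrier G" "q \<in> carrier G \<times> carrier G" "r \<in> carrier G \<times> carrier G"
      and "case_prod f p = case_prod f q \<otimes>\<^bsub>A\<^esub> case_prod f r" for p q r
  proof -
    have "frag_of p - frag_of q \<in> carrier pair_group"
      using that by (simp add: keys_diff_subsetI)
    moreover have "case_prod f q \<in> carrier A" "case_prod f r \<in> carrier A"
      using that f(4) by auto
    ultimately show ?thesis
      using that
      by (simp add: diff g(2) A.m_comm[of "case_prod f q"] A.m_assoc[of _ "case_prod f q"])
  qed
  have "wedge_relations G \<subseteq> kernel pair_group A g"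
  proof
    fix \<rho> assume \<rho>: "\<rho> \<in> wedge_relations G"
    then have "g \<rho> = \<one>\<^bsub>A\<^esub>"
      unfolding wedge_relations_def
      by (elim UnE CollectE exE conjE) (simp_all add: sum f g(2))
    moreover have "\<rho> \<in> carrier pair_group"
      using \<rho> wedge_relations_subset by (rule rev_subsetD)
    ultimately show "\<rho> \<in> kernel pair_group A g"
      unfolding kernel_def by blast
  qed
  then have "wedge_kernel G \<subseteq> kernel pair_group A g"
    unfolding wedge_kernel_def by (rule g.G.generate_subgroup_incl[OF _ g.subgroup_kernel])
  from g.FactGroup_universal_kernel[OF normal_wedge_kernel this] obtain h where
    h: "h \<in> hom (exterior_square G) A"
      "\<And>a. a \<in> carrier pair_group \<Longrightarrow> h (wedge_kernel G #>\<^bsub>pair_group\<^esub> a) = g a"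
    unfolding exterior_square_def by metis
  show ?thesis
    by (rule that[OF h(1)]) (simp add: wedge_def h(2) g(2))
qed

end

section \<open>Pluecker coordinates\<close>

abbreviation Z4 :: "(int \<times> int \<times> int \<times> int) monoid" where
  "Z4 \<equiv> additive_group UNIV"

abbreviation Z6 :: "(int \<times> int \<times> int \<times> int \<times> int \<times> int) monoid" where
  "Z6 \<equiv> additive_group UNIV"

definition Z4_basis :: "(int \<times> int \<times> int \<times> int) set" where
  "Z4_basis = {(1, 0, 0, 0), (0, 1, 0, 0), (0, 0, 1, 0), (0, 0, 0, 1)}"

text \<open>These are the 2 by 2 minors of the matrix whose rows are the two arguments, with columns
  taken in the order 12, 13, 14, 23, 24, 34.\<close>

definition plucker ::
  "int \<times> int \<times> int \<times> int \<Rightarrow> int \<times> int \<times> int \<times> int \<Rightarrow> int \<times> int \<times> int \<times> int \<times> int \<times> int" where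
  "plucker = (\<lambda>(a, b, c, d) (a', b', c', d').
     (a * b' - b * a', a * c' - c * a', a * d' - d * a', b * c' - c * b', b * d' - d * b', c * d' - d * c'))"

lemma alternating_form_plucker: "alternating_form Z4 Z6 plucker"
  unfolding alternating_form_def plucker_def
  by (auto intro!: homI simp: algebra_simps zero_prod_def)

lemma generate_Z4_basis: "generate Z4 Z4_basis = UNIV"
proof -
  have sub: "subgroup (generate Z4 Z4_basis) Z4"
    by (rule group.generate_is_subgroup) auto
  have "e [^]\<^bsub>Z4\<^esub> (n::int) \<in> generate Z4 Z4_basis" if "e \<in> Z4_basis" for e n
    by (rule group.subgroup_int_pow_closed[OF _ sub]) (auto intro: generate.incl that)
  then have *: "(1, 0, 0, 0) [^]\<^bsub>Z4\<^esub> a \<otimes>\<^bsub>Z4\<^esub> (0, 1, 0, 0) [^]\<^bsub>Z4\<^esub> b \<otimes>\<^bsub>Z4\<^esub>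
      (0, 0, 1, 0) [^]\<^bsub>Z4\<^esub> c \<otimes>\<^bsub>Z4\<^esub> (0, 0, 0, 1) [^]\<^bsub>Z4\<^esub> d \<in> generate Z4 Z4_basis"
    for a b c d :: int
    by (intro subgroup.m_closed[OF sub]) (simp_all add: Z4_basis_def del: additive_group_int_pow_Pair)
  have "(a, b, c, d) \<in> generate Z4 Z4_basis" for a b c d
    using *[of a b c d] by simp
  then show ?thesis
    by auto
qed

text \<open>Freeness of rank 6 is derived here: the universal property turns the minors into a
  homomorphism to \<open>Z6\<close>, and the six wedges of basis vectors define a homomorphism
  back.\<close>

lemma exterior_square_iso_Z6:
  fixes G (structure)
  assumes "comm_group G" and h: "h \<in> iso Z4 G"
  obtains P where "P \<in> iso (exterior_square G) Z6"
    "\<And>s t. P (wedge G (h s) (h t)) = plucker s t"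
proof -
  interpret comm_group G by fact
  let ?E = "exterior_square G"
  interpret E: comm_group ?E
    by (rule comm_group_exterior_square)
  have hom_h: "h \<in> hom Z4 G" and inj_h: "inj h" and range_h: "range h = carrier G"
    using h by (auto simp: iso_def bij_betw_def)
  define k where "k = inv_into UNIV h"
  have k_h: "k (h s) = s" for s
    unfolding k_def using inj_h by simp
  have h_closed: "h s \<in> carrier G" for s
    using range_h by blast
  have "k \<in> hom G Z4"
    unfolding k_def using group.iso_set_sym[OF group_additive_group_UNIV h] by (simp add: iso_def)
  with alternating_form_plucker have "alternating_form G Z6 (\<lambda>x y. plucker (k x) (k y))"
    by (rule alternating_form_comp_hom)
  then obtain P where P: "P \<in> hom ?E Z6"
      "\<And>x y. x \<in> carrier G \<Longrightarrow> y \<in> carrier G \<Longrightarrow> P (wedge G x y) = plucker (k x) (k y)"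
    by (rule exterior_square_universal) auto
  have P_wedge: "P (wedge G (h s) (h t)) = plucker s t" for s t
    by (simp add: P(2) h_closed k_h)
  interpret P: group_hom ?E Z6 P
    using P(1) by (simp add: group_hom_def group_hom_axioms_def)

  define W where "W s t = wedge G (h s) (h t)" for s t
  have W_closed [simp]: "W s t \<in> carrier ?E" for s t
    unfolding W_def by (intro wedge_closed h_closed)
  \<comment> \<open>\<open>S\<close> is the inverse of \<open>P\<close>. That \<open>S \<circ> P\<close> is the identity need only be checked on
    wedges of basis vectors, since alternating forms agreeing there are equal.\<close>
  define S where "S = (\<lambda>(p, q, r, x, y, z).
      W (1, 0, 0, 0) (0, 1, 0, 0) [^]\<^bsub>?E\<^esub> (p::int) \<otimes>\<^bsub>?E\<^esub>
      W (1, 0, 0, 0) (0, 0, 1, 0) [^]\<^bsub>?E\<^esub> (q::int) \<otimes>\<^bsub>?E\<^esub>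
      W (1, 0, 0, 0) (0, 0, 0, 1) [^]\<^bsub>?E\<^esub> (r::int) \<otimes>\<^bsub>?E\<^esub>
      W (0, 1, 0, 0) (0, 0, 1, 0) [^]\<^bsub>?E\<^esub> (x::int) \<otimes>\<^bsub>?E\<^esub>
      W (0, 1, 0, 0) (0, 0, 0, 1) [^]\<^bsub>?E\<^esub> (y::int) \<otimes>\<^bsub>?E\<^esub>
      W (0, 0, 1, 0) (0, 0, 0, 1) [^]\<^bsub>?E\<^esub> (z::int))"
  have S_hom: "S \<in> hom Z6 ?E"
    unfolding S_def by (rule homI) (auto simp: E.int_pow_mult E.m_ac)
  \<comment> \<open>The minors of the six pairs of basis vectors are the six unit vectors of
    \<open>Z6\<close>.\<close>
  have P_S: "P (S p) = p" for p
    by (cases p) (simp add: S_def P.hom_int_pow, simp add: W_def P_wedge plucker_def)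

  have W_form: "alternating_form Z4 ?E W"
    unfolding W_def by (rule alternating_form_comp_hom[OF alternating_form_wedge hom_h])
  have S_form: "alternating_form Z4 ?E (\<lambda>s t. S (plucker s t))"
    by (rule alternating_form_hom[OF alternating_form_plucker S_hom]) (auto intro: E.is_group)
  \<comment> \<open>\<open>S\<close> uses only wedges of basis vectors in increasing order; the
    reversed and repeated pairs are reduced to these by \<open>W_swap\<close> and
    \<open>W_self\<close>.\<close>
  have W_swap: "W t s = inv\<^bsub>?E\<^esub> W s t" for s t
    by (rule alternating_form_swap[OF W_form]) (simp_all add: E.is_group)
  have W_self: "W s s = \<one>\<^bsub>?E\<^esub>" for s
    using W_form by (cases s) (simp add: alternating_form_def)
  have S_plucker: "S (plucker s t) = W s t" for s t
  proof (rule alternating_form_eqI[OF S_form W_form, where B = Z4_basis])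
    fix s t assume "s \<in> Z4_basis" "t \<in> Z4_basis"
    then show "S (plucker s t) = W s t"
      unfolding Z4_basis_def
      by (elim insertE emptyE)
        (simp_all add: S_def plucker_def W_self E.int_pow_neg
          W_swap[of "(1, 0, 0, 0)" "(0, 1, 0, 0)"] W_swap[of "(1, 0, 0, 0)" "(0, 0, 1, 0)"]
          W_swap[of "(1, 0, 0, 0)" "(0, 0, 0, 1)"] W_swap[of "(0, 1, 0, 0)" "(0, 0, 1, 0)"]
          W_swap[of "(0, 1, 0, 0)" "(0, 0, 0, 1)"] W_swap[of "(0, 0, 1, 0)" "(0, 0, 0, 1)"])
  qed (simp_all add: E.is_group generate_Z4_basis)
  have S_P: "S (P \<omega>) = \<omega>" if "\<omega> \<in> carrier ?E" for \<omega>
  proof (rule exterior_square_hom_ext[where f = "\<lambda>\<omega>. S (P \<omega>)" and g = "\<lambda>\<omega>. \<omega>", OF _ _ E.is_group _ that])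
    show "(\<lambda>\<omega>. S (P \<omega>)) \<in> hom ?E ?E"
      using Group.hom_compose[OF P(1) S_hom] by (simp add: comp_def)
    show "(\<lambda>\<omega>. \<omega>) \<in> hom ?E ?E"
      by (simp add: hom_def)
    fix x y assume "x \<in> carrier G" "y \<in> carrier G"
    then obtain s t where "x = h s" "y = h t"
      unfolding range_h[symmetric] by blast
    then show "S (P (wedge G x y)) = wedge G x y"
      using S_plucker[of s t] by (simp add: P_wedge W_def)
  qed
  have "bij_betw P (carrier ?E) (carrier Z6)"
    by (rule bij_betwI[where g = S]) (simp_all add: P_S S_P hom_in_carrier[OF S_hom] Pi_def)
  then show ?thesis
    by (intro that[of P] isoI P(1) P_wedge)
qed

section \<open>The quadratic forms\<close>

text \<open>Write x = a + \<tau>c and y = b + \<tau>d, with \<tau> as in the theorem. The first two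
  entries are w|x|^2 and w|y|^2, and the last two, \<gamma> and \<eta>, satisfy w x cnj(y) =
  \<gamma> - w\<tau>\<eta>. The equation in \<open>solutions\<close> then says that |x|^2 |y|^2 is
  the squared modulus of x cnj(y).\<close>

definition norm_form ::
  "int \<Rightarrow> int \<Rightarrow> int \<Rightarrow> int \<times> int \<times> int \<times> int \<Rightarrow> int \<times> int \<times> int \<times> int" where
  "norm_form u v w = (\<lambda>(a, b, c, d).
     (w * a\<^sup>2 - u * a * c + v * c\<^sup>2, w * b\<^sup>2 - u * b * d + v * d\<^sup>2,
      w * a * b - u * a * d + v * c * d, a * d - b * c))"

text \<open>The coordinates of \<open>\<lambda> \<and> \<lambda>-bar\<close> in the order of \<open>plucker\<close>, expressed through the values
  \<open>norm_form\<close> takes at \<open>\<lambda>\<close>; see \<open>plucker_bar\<close>.\<close>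

definition plucker_embed ::
  "int \<Rightarrow> int \<Rightarrow> int \<Rightarrow> int \<times> int \<times> int \<times> int \<Rightarrow> int \<times> int \<times> int \<times> int \<times> int \<times> int" where
  "plucker_embed u v w = (\<lambda>(\<alpha>, \<beta>, \<gamma>, \<eta>). (- (v * \<eta>), \<alpha>, \<gamma>, \<gamma> + u * \<eta>, \<beta>, - (w * \<eta>)))"

text \<open>A left inverse of \<open>plucker_embed\<close> for nonzero \<open>w\<close>: the
  division is exact on the image, where the last coordinate is -w\<eta>.\<close>

definition plucker_project ::
  "int \<Rightarrow> int \<times> int \<times> int \<times> int \<times> int \<times> int \<Rightarrow> int \<times> int \<times> int \<times> int" where
  "plucker_project w = (\<lambda>(p, q, r, x, y, z). (q, y, r, - z div w))"

lemma plucker_project_embed: "w \<noteq> 0 \<Longrightarrow> plucker_project w (plucker_embed u v w q) = q"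
  by (cases q) (simp add: plucker_project_def plucker_embed_def)

text \<open>The second argument holds the coordinates of \<lambda>-bar, as computed in
  \<open>lattice_bar_point\<close>.\<close>

lemma plucker_bar:
  "plucker (a, b, c, d) (- v * c, - v * d, w * a - u * c, w * b - u * d) =
     plucker_embed u v w (norm_form u v w (a, b, c, d))"
  by (simp add: plucker_def plucker_embed_def norm_form_def algebra_simps power2_eq_square)

lemma plucker_embed_pow:
  "plucker_embed u v w (q [^]\<^bsub>Z4\<^esub> (n::nat)) = plucker_embed u v w q [^]\<^bsub>Z6\<^esub> n"
  by (cases q) (simp add: plucker_embed_def algebra_simps)

lemma norm_form_pow:
  "norm_form u v w (s [^]\<^bsub>Z4\<^esub> (n::nat)) = norm_form u v w s [^]\<^bsub>Z4\<^esub> (n * n)"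
  by (cases s) (simp add: norm_form_def algebra_simps power2_eq_square)

lemma additive_group_Z4_pow_inject: "n > 0 \<Longrightarrow> s [^]\<^bsub>Z4\<^esub> (n::nat) = t [^]\<^bsub>Z4\<^esub> n \<longleftrightarrow> s = t"
  by (cases s, cases t) simp

lemma additive_group_Z6_pow_inject: "n > 0 \<Longrightarrow> p [^]\<^bsub>Z6\<^esub> (n::nat) = q [^]\<^bsub>Z6\<^esub> n \<longleftrightarrow> p = q"
  by (cases p, cases q) simp

text \<open>Only divisibility of \<eta> is at stake, since the other three values occur as
  coordinates. A common divisor r of the coordinates divides u\<eta>, v\<eta> and w\<eta>, hence
  \<eta> times gcd(u, v, w) = 1.\<close>

lemma root_plucker_embed_iff:
  assumes "gcd u (gcd v w) = 1"
  shows "(\<exists>y\<in>carrier Z6. y [^]\<^bsub>Z6\<^esub> (r::nat) = plucker_embed u v w q) \<longleftrightarrow>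
    (\<exists>y\<in>carrier Z4. y [^]\<^bsub>Z4\<^esub> r = q)"
proof
  assume "\<exists>y\<in>carrier Z4. y [^]\<^bsub>Z4\<^esub> r = q"
  then obtain y where "y [^]\<^bsub>Z4\<^esub> r = q"
    by blast
  then have "plucker_embed u v w y [^]\<^bsub>Z6\<^esub> r = plucker_embed u v w q"
    using plucker_embed_pow[of u v w y r] by simp
  then show "\<exists>y\<in>carrier Z6. y [^]\<^bsub>Z6\<^esub> (r::nat) = plucker_embed u v w q"
    by (intro bexI) simp_all
next
  assume "\<exists>y\<in>carrier Z6. y [^]\<^bsub>Z6\<^esub> (r::nat) = plucker_embed u v w q"
  then obtain y where y: "y [^]\<^bsub>Z6\<^esub> r = plucker_embed u v w q"
    by blast
  obtain \<alpha> \<beta> \<gamma> \<eta> where q: "q = (\<alpha>, \<beta>, \<gamma>, \<eta>)"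
    by (cases q)
  obtain p1 p2 p3 p4 p5 p6 where "y = (p1, p2, p3, p4, p5, p6)"
    by (cases y)
  with y have eqs: "int r * p1 = - (v * \<eta>)" "int r * p2 = \<alpha>" "int r * p3 = \<gamma>"
      "int r * p4 = \<gamma> + u * \<eta>" "int r * p5 = \<beta>" "int r * p6 = - (w * \<eta>)"
    by (simp_all add: q plucker_embed_def)
  have abc: "int r dvd \<alpha>" "int r dvd \<beta>" "int r dvd \<gamma>"
    using eqs by auto
  \<comment> \<open>The multiple u\<eta> is not itself a coordinate; it is the difference of the
    fourth and the third.\<close>
  have "\<eta> * v = int r * (- p1)" "\<eta> * u = int r * (p4 - p3)" "\<eta> * w = int r * (- p6)"
    using eqs by (simp_all add: algebra_simps)
  then have "int r dvd \<eta> * u" "int r dvd \<eta> * v" "int r dvd \<eta> * w"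
    by simp_all
  then have "int r dvd gcd (\<bar>\<eta>\<bar> * u) (gcd (\<bar>\<eta>\<bar> * v) (\<bar>\<eta>\<bar> * w))"
    by (simp add: abs_if)
  also have "\<dots> = \<bar>\<eta>\<bar> * gcd u (gcd v w)"
    by (simp only: gcd_mult_left normalize_int_def abs_abs abs_mult abs_gcd_int)
  also have "\<dots> = \<bar>\<eta>\<bar>"
    using assms by simp
  finally have "int r dvd \<eta>"
    by simp
  with abc show "\<exists>y\<in>carrier Z4. y [^]\<^bsub>Z4\<^esub> r = q"
    unfolding root_Z4_iff by (simp add: q gcd4_def)
qed

text \<open>Multiplying by 4w completes the square; what remains is minus the discriminant times
  \<open>y\<close> squared.\<close>

lemma pos_def_form_nonneg:
  fixes u v w x y :: int
  assumes "w > 0" "u\<^sup>2 - 4 * v * w < 0"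
  shows "w * x\<^sup>2 - u * x * y + v * y\<^sup>2 \<ge> 0"
    and "w * x\<^sup>2 - u * x * y + v * y\<^sup>2 = 0 \<Longrightarrow> x = 0 \<and> y = 0"
proof -
  have eq: "4 * w * (w * x\<^sup>2 - u * x * y + v * y\<^sup>2) = (2 * w * x - u * y)\<^sup>2 + (4 * v * w - u\<^sup>2) * y\<^sup>2"
    by (simp add: algebra_simps power2_eq_square)
  have D: "(4 * v * w - u\<^sup>2) * y\<^sup>2 \<ge> 0"
    using assms by simp
  then have "4 * w * (w * x\<^sup>2 - u * x * y + v * y\<^sup>2) \<ge> 0"
    unfolding eq by simp
  then show "w * x\<^sup>2 - u * x * y + v * y\<^sup>2 \<ge> 0"
    using assms(1) by (simp add: zero_le_mult_iff)
  assume "w * x\<^sup>2 - u * x * y + v * y\<^sup>2 = 0"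
  then have sum0: "(2 * w * x - u * y)\<^sup>2 + (4 * v * w - u\<^sup>2) * y\<^sup>2 = 0"
    using eq by simp
  then have "(4 * v * w - u\<^sup>2) * y\<^sup>2 = 0"
    using D zero_le_power2[of "2 * w * x - u * y"] by linarith
  then have "y = 0"
    using assms(2) by simp
  with sum0 show "x = 0 \<and> y = 0"
    using assms(1) by simp
qed

lemma norm_form_eq_0D:
  assumes "w > 0" "u\<^sup>2 - 4 * v * w < 0" "norm_form u v w s = 0"
  shows "s = 0"
proof (cases s)
  case (fields a b c d)
  then show ?thesis
    using assms(3) pos_def_form_nonneg(2)[OF assms(1,2), of a c]
      pos_def_form_nonneg(2)[OF assms(1,2), of b d]
    by (simp add: norm_form_def zero_prod_def)
qed

text \<open>Comparing contents shows that i divides j; as \<int>^4 is torsion-free, the factor i can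
  then be cancelled.\<close>

lemma primitive_pow_cases:
  assumes "gcd4 t = 1" "x [^]\<^bsub>Z4\<^esub> i = t [^]\<^bsub>Z4\<^esub> (j::nat)" "(i::nat) > 0" "j > 0"
  obtains m :: nat where "m > 0" "x = t [^]\<^bsub>Z4\<^esub> m"
proof -
  define m where "m = nat (gcd4 x)"
  have "int i * gcd4 x = int j"
    using arg_cong[OF assms(2), of gcd4] assms(1) by (simp add: gcd4_pow)
  then have j: "j = m * i"
    using gcd4_nonneg[of x] unfolding m_def by (metis int_nat_eq mult.commute nat_int of_nat_mult)
  have "x [^]\<^bsub>Z4\<^esub> i = (t [^]\<^bsub>Z4\<^esub> m) [^]\<^bsub>Z4\<^esub> i"
    unfolding assms(2) j
    by (rule monoid.nat_pow_pow[symmetric]) (simp_all add: group.is_monoid)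
  then have "x = t [^]\<^bsub>Z4\<^esub> m"
    using assms(3) by (simp add: additive_group_Z4_pow_inject)
  moreover have "m > 0"
    using j assms(4) by simp
  ultimately show ?thesis
    by (rule that[rotated])
qed

lemma norm_form_multiple_in_solutions:
  assumes "w > 0" "u\<^sup>2 - 4 * v * w < 0"
    and "gcd4 t = 1" "norm_form u v w s = t [^]\<^bsub>Z4\<^esub> (n::nat)" "n > 0"
  shows "t \<in> solutions u v w"
proof -
  obtain a b c d where s: "s = (a, b, c, d)"
    by (cases s)
  obtain \<alpha> \<beta> \<gamma> \<eta> where t: "t = (\<alpha>, \<beta>, \<gamma>, \<eta>)"
    by (cases t)
  have eqs: "int n * \<alpha> = w * a\<^sup>2 - u * a * c + v * c\<^sup>2" "int n * \<beta> = w * b\<^sup>2 - u * b * d + v * d\<^sup>2"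
      "int n * \<gamma> = w * a * b - u * a * d + v * c * d" "int n * \<eta> = a * d - b * c"
    using assms(4) by (simp_all add: s t norm_form_def)
  have nonneg: "int n * \<alpha> \<ge> 0" "int n * \<beta> \<ge> 0"
    unfolding eqs by (rule pos_def_form_nonneg[OF assms(1,2)])+
  \<comment> \<open>The equation is homogeneous of degree two, so it may be checked after scaling by
    \<open>n\<close>, where it is an identity in a, b, c, d.\<close>
  have "(int n)\<^sup>2 * (\<alpha> * \<beta> - \<gamma> * (\<gamma> + u * \<eta>) - v * w * \<eta>\<^sup>2) =
      (int n * \<alpha>) * (int n * \<beta>) - (int n * \<gamma>) * (int n * \<gamma> + u * (int n * \<eta>)) - v * w * (int n * \<eta>)\<^sup>2"
    by (simp add: algebra_simps power2_eq_square)
  also have "\<dots> = 0"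
    unfolding eqs by (simp add: algebra_simps power2_eq_square)
  finally have "\<alpha> * \<beta> - \<gamma> * (\<gamma> + u * \<eta>) = v * w * \<eta>\<^sup>2"
    using assms(5) by simp
  with nonneg assms(3,5) show ?thesis
    by (simp add: solutions_def t primitive_Z4_iff zero_le_mult_iff)
qed

lemma solution_is_norm_form_part:
  assumes "w > 0" "u\<^sup>2 - 4 * v * w < 0" "t \<in> solutions u v w"
  obtains s n where "gcd4 s = 1" "norm_form u v w s = t [^]\<^bsub>Z4\<^esub> (n::nat)" "n > 0"
proof -
  obtain \<alpha> \<beta> \<gamma> \<eta> where t: "t = (\<alpha>, \<beta>, \<gamma>, \<eta>)"
    by (cases t)
  have gcd: "gcd4 t = 1" and nonneg: "\<alpha> \<ge> 0" "\<beta> \<ge> 0"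
    and eq: "\<alpha> * \<beta> - \<gamma> * (\<gamma> + u * \<eta>) = v * w * \<eta>\<^sup>2"
    using assms(3) by (simp_all add: solutions_def t primitive_Z4_iff)
  show ?thesis
  proof (cases "\<alpha> = 0")
    case True
    \<comment> \<open>Completing the square in \<gamma> makes the equation a vanishing sum of two
      nonnegative terms.\<close>
    have "(2 * \<gamma> + u * \<eta>)\<^sup>2 + (4 * v * w - u\<^sup>2) * \<eta>\<^sup>2 = 4 * (\<gamma> * (\<gamma> + u * \<eta>) + v * w * \<eta>\<^sup>2)"
      by (simp add: algebra_simps power2_eq_square)
    also have "\<dots> = 0"
      using eq True by simp
    finally have sum0: "(2 * \<gamma> + u * \<eta>)\<^sup>2 + (4 * v * w - u\<^sup>2) * \<eta>\<^sup>2 = 0" .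
    moreover have "(4 * v * w - u\<^sup>2) * \<eta>\<^sup>2 \<ge> 0"
      using assms(2) by simp
    ultimately have "(4 * v * w - u\<^sup>2) * \<eta>\<^sup>2 = 0"
      using zero_le_power2[of "2 * \<gamma> + u * \<eta>"] by linarith
    then have "\<eta> = 0"
      using assms(2) by simp
    with sum0 have "\<gamma> = 0"
      by simp
    with \<open>\<eta> = 0\<close> True gcd nonneg have "t = (0, 1, 0, 0)"
      by (simp add: t gcd4_def)
    then show ?thesis
      \<comment> \<open>The vector \<lambda> = (0, 1) has the values (0, w, 0, 0), which is w times
        this solution.\<close>
      using assms(1) by (intro that[of "(0, 1, 0, 0)" "nat w"]) (simp_all add: gcd4_def norm_form_def)
  next
    case False
    \<comment> \<open>Only \<open>\<lambda>\<close> up to a factor in \<open>\<rat>(\<tau>)\<close> matters, so its first entry may be taken to be \<open>\<alpha>\<close>;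
      the values of the last two forms then force the second entry.\<close>
    let ?s = "(\<alpha>, \<gamma> + u * \<eta>, 0, w * \<eta>)"
    have \<beta>: "\<alpha> * \<beta> = \<gamma> * (\<gamma> + u * \<eta>) + v * w * \<eta>\<^sup>2"
      using eq by simp
    have "w * (\<gamma> + u * \<eta>)\<^sup>2 - u * (\<gamma> + u * \<eta>) * (w * \<eta>) + v * (w * \<eta>)\<^sup>2 = w * (\<alpha> * \<beta>)"
      unfolding \<beta> by (simp add: algebra_simps power2_eq_square)
    then have s: "norm_form u v w ?s = t [^]\<^bsub>Z4\<^esub> nat (w * \<alpha>)"
      using assms(1) nonneg by (simp add: norm_form_def t algebra_simps power2_eq_square)
    obtain s' k where s': "gcd4 s' = 1" "k > 0" "?s = s' [^]\<^bsub>Z4\<^esub> (k::nat)"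
      by (rule gcd4_divide[of ?s]) (use False in \<open>simp add: zero_prod_def\<close>)
    \<comment> \<open>Making the vector primitive divides its values by k^2. That the result is
      still an integral multiple of \<open>t\<close> comes from the primitivity of
      \<open>t\<close>.\<close>
    have "norm_form u v w s' [^]\<^bsub>Z4\<^esub> (k * k) = t [^]\<^bsub>Z4\<^esub> nat (w * \<alpha>)"
      using s unfolding s'(3) norm_form_pow .
    then obtain m where "m > 0" "norm_form u v w s' = t [^]\<^bsub>Z4\<^esub> (m::nat)"
      by (rule primitive_pow_cases[OF gcd]) (use s'(2) False nonneg assms(1) in auto)
    with s'(1) show ?thesis
      by (intro that)
  qed
qed

section \<open>The correspondence\<close>

text \<open>The content is carried through \<open>P\<close> to \<open>Z6\<close> and through
  \<open>plucker_embed\<close> to \<open>Z4\<close>, where it is a gcd. Division by \<open>n\<close>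
  is then detected on coordinates, as \<open>P\<close> is injective and \<open>Z6\<close>
  torsion-free.\<close>

lemma primitive_part_content_iff:
  assumes "P \<in> iso E Z6" "group E" "x \<in> carrier E" "gcd u (gcd v w) = 1"
    and "P x = plucker_embed u v w (t [^]\<^bsub>Z4\<^esub> (n::nat))" "gcd4 t = 1" "n > 0"
  shows "integral_content E x = n"
    and "is_primitive_part E x \<omega> \<longleftrightarrow> \<omega> \<in> carrier E \<and> P \<omega> = plucker_embed u v w t"
proof -
  have P: "P \<in> hom E Z6" "inj_on P (carrier E)"
    using assms(1) by (auto simp: iso_def bij_betw_def)
  \<comment> \<open>At zero the content would be unspecified.\<close>
  have nonzero: "t [^]\<^bsub>Z4\<^esub> n \<noteq> 0"
    using gcd4_pow[of t n] assms(6,7) by (auto simp: gcd4_eq_0_iff[symmetric])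
  have "integral_content E x = integral_content Z6 (P x)"
    by (rule integral_content_iso[symmetric]) (use assms in simp_all)
  also have "\<dots> = integral_content Z4 (t [^]\<^bsub>Z4\<^esub> n)"
    unfolding assms(5) by (rule integral_content_cong) (rule root_plucker_embed_iff[OF assms(4)])
  also have "\<dots> = n"
    using integral_content_Z4[OF nonzero] assms(6) by (simp add: gcd4_pow)
  finally show content: "integral_content E x = n" .
  have "\<omega> [^]\<^bsub>E\<^esub> n = x \<longleftrightarrow> P \<omega> = plucker_embed u v w t" if "\<omega> \<in> carrier E"
  proof -
    have "\<omega> [^]\<^bsub>E\<^esub> n = x \<longleftrightarrow> P (\<omega> [^]\<^bsub>E\<^esub> n) = P x"
      using inj_on_eq_iff[OF P(2) _ assms(3)] monoid.nat_pow_closed[OF group.is_monoid[OF assms(2)] that]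
      by simp
    also have "\<dots> \<longleftrightarrow> P \<omega> [^]\<^bsub>Z6\<^esub> n = plucker_embed u v w t [^]\<^bsub>Z6\<^esub> n"
      unfolding assms(5) plucker_embed_pow
        hom_nat_pow[OF P(1) that assms(2) group_additive_group_UNIV] ..
    finally show ?thesis
      using additive_group_Z6_pow_inject[OF assms(7)] by simp
  qed
  then show "is_primitive_part E x \<omega> \<longleftrightarrow> \<omega> \<in> carrier E \<and> P \<omega> = plucker_embed u v w t"
    unfolding is_primitive_part_def content by blast
qed

section \<open>Integer coordinates on the lattice\<close>

lemma lattice_point_add:
  "lattice_point \<tau> a b c d + lattice_point \<tau> a' b' c' d' =
     lattice_point \<tau> (a + a') (b + b') (c + c') (d + d')"
  by (simp add: lattice_point_def vec_eq_iff forall_2 algebra_simps)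

text \<open>As \<tau> is not real, imaginary parts determine the coefficients of \<tau>, and then
  the rest follows.\<close>

lemma lattice_point_inject:
  assumes "Im \<tau> > 0" "lattice_point \<tau> a b c d = lattice_point \<tau> a' b' c' d'"
  shows "a = a' \<and> b = b' \<and> c = c' \<and> d = d'"
proof -
  have coord: "p = p' \<and> q = q'"
    if "of_int p + \<tau> * of_int q = of_int p' + \<tau> * of_int q'" for p q p' q' :: int
  proof -
    have "q = q'"
      using assms(1) arg_cong[OF that, of Im] by simp
    with that show ?thesis
      by simp
  qed
  show ?thesis
    using assms(2) coord[of a c a' c'] coord[of b d b' d']
    by (simp add: lattice_point_def vec_eq_iff forall_2)
qed

lemma lattice_bar_point:
  assumes "of_int w * \<tau>\<^sup>2 + of_int u * \<tau> + of_int v = 0"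
  shows "lattice_bar \<tau> w (lattice_point \<tau> a b c d) =
    lattice_point \<tau> (- v * c) (- v * d) (w * a - u * c) (w * b - u * d)"
proof -
  have rel: "of_int w * (\<tau> * \<tau>) = - of_int v - of_int u * \<tau>"
    using assms by (simp add: power2_eq_square add_eq_0_iff algebra_simps)
  have "of_int w * \<tau> * (of_int p + \<tau> * of_int q) = of_int (- v * q) + \<tau> * of_int (w * p - u * q)"
    for p q
  proof -
    have "of_int w * \<tau> * (of_int p + \<tau> * of_int q) =
        of_int w * \<tau> * of_int p + of_int w * (\<tau> * \<tau>) * of_int q"
      by (simp add: algebra_simps)
    then show ?thesis
      unfolding rel by (simp add: algebra_simps)
  qed
  from this[of a c] this[of b d] show ?thesis
    unfolding lattice_bar_def lattice_point_def vec_eq_iff forall_2 by simp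
qed

lemma lattice_point_iso:
  assumes "Im \<tau> > 0"
  shows "(\<lambda>(a, b, c, d). lattice_point \<tau> a b c d) \<in> iso Z4 (Lattice \<tau>)"
proof (rule isoI)
  show "(\<lambda>(a, b, c, d). lattice_point \<tau> a b c d) \<in> hom Z4 (Lattice \<tau>)"
    by (rule homI) (auto simp: Lattice_def lattice_point_add)
  show "bij_betw (\<lambda>(a, b, c, d). lattice_point \<tau> a b c d) (carrier Z4) (carrier (Lattice \<tau>))"
    unfolding bij_betw_def
  proof
    show "inj_on (\<lambda>(a, b, c, d). lattice_point \<tau> a b c d) (carrier Z4)"
      by (rule inj_onI) (auto dest: lattice_point_inject[OF assms])
    show "(\<lambda>(a, b, c, d). lattice_point \<tau> a b c d) ` carrier Z4 = carrier (Lattice \<tau>)"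
      by (auto simp: Lattice_def image_iff) blast
  qed
qed

lemma comm_group_Lattice: "comm_group (Lattice \<tau>)"
  unfolding Lattice_def
proof (rule comm_group_additive_group)
  have "lattice_point \<tau> 0 0 0 0 = 0"
    by (simp add: lattice_point_def vec_eq_iff forall_2)
  then show "0 \<in> {lattice_point \<tau> a b c d | a b c d. True}"
    by (metis (mono_tags, lifting) mem_Collect_eq)
next
  have "- lattice_point \<tau> a b c d = lattice_point \<tau> (- a) (- b) (- c) (- d)" for a b c d
    by (simp add: lattice_point_def vec_eq_iff forall_2)
  then show "- l \<in> {lattice_point \<tau> a b c d | a b c d. True}"
    if "l \<in> {lattice_point \<tau> a b c d | a b c d. True}" for l
    using that by blast
next
  show "l + l' \<in> {lattice_point \<tau> a b c d | a b c d. True}"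
    if "l \<in> {lattice_point \<tau> a b c d | a b c d. True}" "l' \<in> {lattice_point \<tau> a b c d | a b c d. True}"
    for l l'
    using that lattice_point_add by blast
qed

theorem theorem4p1:
  fixes \<tau> :: complex and u v w :: int
  assumes "Im \<tau> > 0"
    and "of_int w * \<tau>\<^sup>2 + of_int u * \<tau> + of_int v = 0"
    and "w > 0"
    and "gcd u (gcd v w) = 1"
    and "u\<^sup>2 - 4 * v * w < 0"
  shows "\<exists>\<Phi>. bij_betw \<Phi> (bivectors \<tau> w) (solutions u v w) \<and>
    (\<forall>a b c d \<omega> l r \<alpha> \<beta> \<gamma> \<eta>.
       l = lattice_point \<tau> a b c d \<and> primitive (Lattice \<tau>) l \<and>
       r = integral_content (exterior_square (Lattice \<tau>))
             (wedge (Lattice \<tau>) l (lattice_bar \<tau> w l)) \<and>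
       is_primitive_part (exterior_square (Lattice \<tau>))
         (wedge (Lattice \<tau>) l (lattice_bar \<tau> w l)) \<omega> \<and>
       \<Phi> \<omega> = (\<alpha>, \<beta>, \<gamma>, \<eta>) \<longrightarrow>
         int r * \<alpha> = w * a\<^sup>2 - u * a * c + v * c\<^sup>2 \<and>
         int r * \<beta> = w * b\<^sup>2 - u * b * d + v * d\<^sup>2 \<and>
         int r * \<gamma> = w * a * b - u * a * d + v * c * d \<and>
         int r * \<eta> = a * d - b * c)"
proof -
  let ?L = "Lattice \<tau>"
  let ?E = "exterior_square ?L"
  let ?wb = "\<lambda>l. wedge ?L l (lattice_bar \<tau> w l)"
  interpret L: comm_group ?L
    by (rule comm_group_Lattice)
  define h where "h = (\<lambda>(a, b, c, d). lattice_point \<tau> a b c d)"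
  have h_iso: "h \<in> iso Z4 ?L"
    unfolding h_def by (rule lattice_point_iso[OF assms(1)])
  then have range_h: "range h = carrier ?L"
    by (auto simp: iso_def bij_betw_def)
  obtain P where P: "P \<in> iso ?E Z6" "\<And>s t. P (wedge ?L (h s) (h t)) = plucker s t"
    using exterior_square_iso_Z6[OF comm_group_Lattice h_iso] by blast
  have P_bij: "inj_on P (carrier ?E)" "P ` carrier ?E = UNIV"
    using P(1) by (auto simp: iso_def bij_betw_def)
  have bar_closed: "lattice_bar \<tau> w (h s) \<in> carrier ?L" for s
    using lattice_bar_closed[OF assms(2)] range_h by blast
  have P_wb: "P (?wb (h s)) = plucker_embed u v w (norm_form u v w s)" for s
  proof (cases s)
    case (fields a b c d)
    have "lattice_bar \<tau> w (h s) = h (- v * c, - v * d, w * a - u * c, w * b - u * d)"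
      by (simp add: fields h_def lattice_bar_point[OF assms(2)])
    then show ?thesis
      using plucker_bar[of a b c d v w u] by (simp add: P(2) fields)
  qed
  have primitive_h: "primitive ?L (h s) \<longleftrightarrow> gcd4 s = 1" for s
    using primitive_iso[OF h_iso _ L.is_group, of s] by (simp add: primitive_Z4_iff)
  \<comment> \<open>Writing the values at a lattice vector as n times a primitive \<open>t\<close>
    yields both the content of its bivector and the coordinates of the primitive part.\<close>
  have part: "integral_content ?E (?wb (h s)) = n \<and>
      (is_primitive_part ?E (?wb (h s)) \<omega> \<longleftrightarrow> \<omega> \<in> carrier ?E \<and> P \<omega> = plucker_embed u v w t)"
    if "norm_form u v w s = t [^]\<^bsub>Z4\<^esub> n" "gcd4 t = 1" "n > 0" for s t n \<omega>
    using primitive_part_content_iff[OF P(1) L.group_exterior_square _ assms(4) _ that(2,3),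
        of "?wb (h s)"] that(1) P_wb[of s] L.wedge_closed[OF _ bar_closed, of "h s" s] range_h
    by auto
  have norm_form_part: "\<exists>t n. norm_form u v w s = t [^]\<^bsub>Z4\<^esub> (n::nat) \<and> gcd4 t = 1 \<and> n > 0"
    if "gcd4 s = 1" for s
  proof -
    have "s \<noteq> 0"
      using that gcd4_eq_0_iff[of s] by auto
    \<comment> \<open>Definiteness keeps \<lambda> \<and> \<lambda>-bar away from zero, so it has a
      well-defined content.\<close>
    then have "norm_form u v w s \<noteq> 0"
      using norm_form_eq_0D[OF assms(3,5)] by blast
    then show ?thesis
      by (metis gcd4_divide)
  qed
  \<comment> \<open>In coordinates the bivectors are exactly the image of
    \<open>solutions u v w\<close> under \<open>plucker_embed\<close>; bijectivity of \<Phi> is then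
    formal.\<close>
  have bivectors_iff: "\<omega> \<in> bivectors \<tau> w \<longleftrightarrow>
      \<omega> \<in> carrier ?E \<and> (\<exists>t\<in>solutions u v w. P \<omega> = plucker_embed u v w t)" for \<omega>
  proof
    assume "\<omega> \<in> bivectors \<tau> w"
    then obtain l where l: "primitive ?L l" "is_primitive_part ?E (?wb l) \<omega>"
      by (auto simp: bivectors_def)
    then obtain s where s: "l = h s"
      using range_h unfolding primitive_def by blast
    with l(1) have "gcd4 s = 1"
      by (simp add: primitive_h)
    then obtain t n where t: "norm_form u v w s = t [^]\<^bsub>Z4\<^esub> (n::nat)" "gcd4 t = 1" "n > 0"
      using norm_form_part by blast
    have "t \<in> solutions u v w"
      by (rule norm_form_multiple_in_solutions[OF assms(3,5) t(2,1,3)])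
    with part[OF t] l(2) show "\<omega> \<in> carrier ?E \<and> (\<exists>t\<in>solutions u v w. P \<omega> = plucker_embed u v w t)"
      unfolding s by blast
  next
    assume "\<omega> \<in> carrier ?E \<and> (\<exists>t\<in>solutions u v w. P \<omega> = plucker_embed u v w t)"
    then obtain t where t: "\<omega> \<in> carrier ?E" "t \<in> solutions u v w" "P \<omega> = plucker_embed u v w t"
      by blast
    obtain s n where s: "gcd4 s = 1" "norm_form u v w s = t [^]\<^bsub>Z4\<^esub> (n::nat)" "n > 0"
      using solution_is_norm_form_part[OF assms(3,5) t(2)] .
    have "gcd4 t = 1"
      using t(2) by (cases t) (simp add: solutions_def primitive_Z4_iff)
    then have "is_primitive_part ?E (?wb (h s)) \<omega>"
      using part[OF s(2) _ s(3)] t by blast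
    then show "\<omega> \<in> bivectors \<tau> w"
      unfolding bivectors_def using s(1) primitive_h by blast
  qed
  define \<Phi> where "\<Phi> = (\<lambda>\<omega>. plucker_project w (P \<omega>))"
  have \<Phi>_eq: "\<Phi> \<omega> = t" if "P \<omega> = plucker_embed u v w t" for \<omega> t
    using assms(3) that by (simp add: \<Phi>_def plucker_project_embed)
  have "bij_betw \<Phi> (bivectors \<tau> w) (solutions u v w)"
    unfolding bij_betw_def
  proof
    show "inj_on \<Phi> (bivectors \<tau> w)"
    proof (rule inj_onI)
      fix \<omega> \<omega>' assume "\<omega> \<in> bivectors \<tau> w" "\<omega>' \<in> bivectors \<tau> w" "\<Phi> \<omega> = \<Phi> \<omega>'"
      then have "\<omega> \<in> carrier ?E" "\<omega>' \<in> carrier ?E" "P \<omega> = P \<omega>'"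
        unfolding bivectors_iff using \<Phi>_eq by metis+
      then show "\<omega> = \<omega>'"
        using P_bij(1) by (simp add: inj_on_eq_iff)
    qed
    show "\<Phi> ` bivectors \<tau> w = solutions u v w"
    proof
      show "\<Phi> ` bivectors \<tau> w \<subseteq> solutions u v w"
        using \<Phi>_eq bivectors_iff by blast
      show "solutions u v w \<subseteq> \<Phi> ` bivectors \<tau> w"
      proof
        fix t assume t: "t \<in> solutions u v w"
        obtain \<omega> where "\<omega> \<in> carrier ?E" "P \<omega> = plucker_embed u v w t"
          using P_bij(2) by (metis UNIV_I imageE)
        with t show "t \<in> \<Phi> ` bivectors \<tau> w"
          using \<Phi>_eq bivectors_iff by blast
      qed
    qed
  qed
  moreover have "int r * \<alpha> = w * a\<^sup>2 - u * a * c + v * c\<^sup>2 \<and>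
      int r * \<beta> = w * b\<^sup>2 - u * b * d + v * d\<^sup>2 \<and>
      int r * \<gamma> = w * a * b - u * a * d + v * c * d \<and>
      int r * \<eta> = a * d - b * c"
    if l: "l = lattice_point \<tau> a b c d" "primitive ?L l" "r = integral_content ?E (?wb l)"
      "is_primitive_part ?E (?wb l) \<omega>" "\<Phi> \<omega> = (\<alpha>, \<beta>, \<gamma>, \<eta>)"
    for a b c d \<omega> l r \<alpha> \<beta> \<gamma> \<eta>
  proof -
    have h: "l = h (a, b, c, d)"
      by (simp add: h_def l(1))
    have "gcd4 (a, b, c, d) = 1"
      using l(2) unfolding h primitive_h .
    then obtain t n where t: "norm_form u v w (a, b, c, d) = t [^]\<^bsub>Z4\<^esub> (n::nat)" "gcd4 t = 1" "n > 0"
      using norm_form_part by blast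
    from part[OF t, of \<omega>] l(3,4) have "r = n" "P \<omega> = plucker_embed u v w t"
      unfolding h by blast+
    with l(5) \<Phi>_eq t(1) have "norm_form u v w (a, b, c, d) = (\<alpha>, \<beta>, \<gamma>, \<eta>) [^]\<^bsub>Z4\<^esub> r"
      by metis
    then show ?thesis
      by (simp add: norm_form_def)
  qed
  ultimately show ?thesis
    by (intro exI[of _ \<Phi>]) blast
qed

end
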